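(* Let $a<b$ be real numbers, let $1<\alpha\le 2$, and let $q:[a,b]\to\mathbb{R}$ be a nontrivial (i.e. not almost everywhere zero) Lebesgue integrable function. Assume that $f\in C(\mathbb{R}_+,\mathbb{R}_+)$ is a concave and nondecreasing function. If the fractional boundary value problem $$\begin{cases} {}_aD^{\alpha}y+q(t)f(y)=0,\quad a<t<b,\\ y(a)=y(b)=0\end{cases}$$ has a nontrivial solution $y$, then $$\int_a^b|q(t)|\,dt>\frac{4^{\alpha-1}\,\Gamma(\alpha)\,\eta}{(b-a)^{\alpha-1}f(\eta)},$$ where $\eta=\max_{t\in[a,b]}y(t)$.
   Context: $\mathbb{R}_+=[0,\infty)$. The (left) Riemann--Liouville fractional derivative of order $\alpha>0$ of $u:[a,b]\to\mathbb{R}$ is $${}_aD^{\alpha}u(t)=\frac{1}{\Gamma(n-\alpha)}\frac{d^n}{dt^n}\int_a^t\frac{u(s)}{(t-s)^{\alpha-n+1}}\,ds,\qquad n=[\alpha]+1.$$ Solutions of the boundary value problem are continuous functions $y$ on $[a,b]$ with values in $\mathbb{R}_+$ (the domain of $f$), and are understood through the equivalent integral equation: $y$ is a solution if and only if $y(t)=\int_a^b G(t,s)q(s)f(y(s))\,ds$ for all $t\in[a,b]$, where $$G(t,s)=\frac{1}{\Gamma(\alpha)}\begin{cases}\dfrac{(t-a)^{\alpha-1}(b-s)^{\alpha-1}}{(b-a)^{\alpha-1}}-(t-s)^{\alpha-1}, & a\le s\le t\le b,\\[2mm] \dfrac{(t-a)^{\alpha-1}(b-s)^{\alpha-1}}{(b-a)^{\alpha-1}},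 & a\le t\le s\le b.\end{cases}$$ "Nontrivial" solution means not identically zero. *)

theory Defs
  imports "HOL-Analysis.Analysis"
begin

definition green :: "real \<Rightarrow> real \<Rightarrow> real \<Rightarrow> real \<Rightarrow> real \<Rightarrow> real" where
  "green \<alpha> a b t s = 1 / Gamma \<alpha> *
     (if s \<le> t
      then (t - a) powr (\<alpha> - 1) * (b - s) powr (\<alpha> - 1) / (b - a) powr (\<alpha> - 1)
             - (t - s) powr (\<alpha> - 1)
      else (t - a) powr (\<alpha> - 1) * (b - s) powr (\<alpha> - 1) / (b - a) powr (\<alpha> - 1))"

(* Solutions of the Riemann-Liouville problem D^\<alpha> y + q f(y) = 0 on (a,b), y(a) = y(b) = 0, are
   by convention the continuous nonnegative solutions of the equivalent integral equation with
   kernel green; for merely integrable q the differential equation need not hold pointwise.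
   Only the values of q and y on [a,b] and of f on [0,\<infinity>) matter. *)
definition frac_bvp_solution ::
  "real \<Rightarrow> real \<Rightarrow> real \<Rightarrow> (real \<Rightarrow> real) \<Rightarrow> (real \<Rightarrow> real) \<Rightarrow> (real \<Rightarrow> real) \<Rightarrow> bool" where
  "frac_bvp_solution \<alpha> a b q f y \<longleftrightarrow>
     continuous_on {a..b} y \<and>
     (\<forall>t\<in>{a..b}. 0 \<le> y t) \<and>
     (\<forall>t\<in>{a..b}. y t = (LINT s:{a..b}|lebesgue. green \<alpha> a b t s * q s * f (y s)))"

(* The supremum of a solution over [a,b] is a maximum. *)
lemma frac_bvp_solution_SUP_attained:
  assumes "a \<le> b" and "frac_bvp_solution \<alpha> a b q f y"
  shows "(SUP t\<in>{a..b}. y t) \<in> y ` {a..b}"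
    and "t \<in> {a..b} \<Longrightarrow> y t \<le> (SUP t\<in>{a..b}. y t)"
proof -
  have "compact (y ` {a..b})"
    using assms(2) unfolding frac_bvp_solution_def by (intro compact_continuous_image) (blast, rule compact_Icc)
  moreover from this have bdd: "bdd_above (y ` {a..b})"
    by (simp add: bounded_imp_bdd_above compact_imp_bounded)
  ultimately show "(SUP t\<in>{a..b}. y t) \<in> y ` {a..b}"
    using \<open>a \<le> b\<close> by (intro closed_contains_Sup) (auto simp: compact_imp_closed)
  show "t \<in> {a..b} \<Longrightarrow> y t \<le> (SUP t\<in>{a..b}. y t)"
    using bdd by (intro cSUP_upper)
qed

end

theory Submission imports Defs
begin

text \<open>
  The inequality comes from evaluating the integral equation at a point \<open>t\<close> where \<open>y\<close> attains
  its maximum \<open>\<eta>\<close>. Since \<open>f\<close> is nondecreasing, \<open>f (y s) \<le> f \<eta>\<close>, so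
  \<open>\<eta> \<le> f \<eta> * (\<integral> green \<alpha> a b t s * \<bar>q s\<bar> ds)\<close>, and everything rests on the size of the kernel.
  It is nonnegative (\<open>green_nonneg\<close>) and dominated by its diagonal value (\<open>green_le_diagonal\<close>),
  which is \<open>((s - a) * (b - s) / (b - a)) powr (\<alpha> - 1) / Gamma \<alpha>\<close>. By the inequality of
  arithmetic and geometric means this is at most \<open>K = ((b - a) / 4) powr (\<alpha> - 1) / Gamma \<alpha>\<close>, with
  equality only at the midpoint of the interval (\<open>green_less\<close>).

  The midpoint is a null set and \<open>q\<close> is not almost everywhere zero, so the estimate
  \<open>\<eta> < K * f \<eta> * (\<integral> \<bar>q s\<bar> ds)\<close> is strict. Dividing by \<open>K * f \<eta>\<close> gives the claim; here
  \<open>f \<eta> > 0\<close>, because otherwise \<open>f (y s)\<close> would vanish identically and force \<open>\<eta> = 0\<close>.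
\<close>

lemma powr_subadditive:
  fixes x y c :: real
  assumes "0 \<le> x" "0 \<le> y" "0 < c" "c \<le> 1"
  shows "(x + y) powr c \<le> x powr c + y powr c"
proof (cases "x + y = 0")
  case True
  then show ?thesis by simp
next
  case False
  then have pos: "x + y > 0" using assms by simp
  \<comment> \<open>On \<open>[0, 1]\<close> the power \<open>c \<le> 1\<close> lies above the identity; apply this to the two proportions
    \<open>x / (x + y)\<close> and \<open>y / (x + y)\<close>, which sum to \<open>1\<close>.\<close>
  have frac: "z * (x + y) powr c \<le> (z * (x + y)) powr c" if "0 \<le> z" "z \<le> 1" for z
  proof -
    have "z \<le> z powr c"
      using powr_mono'[of c 1 z] that assms by simp
    then show ?thesis
      using that pos by (simp add: powr_mult mult_right_mono)
  qed
  have "(x + y) powr c = (x / (x + y) + y / (x + y)) * (x + y) powr c"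
    using pos by (simp flip: add_divide_distrib)
  also have "\<dots> \<le> x powr c + y powr c"
    using frac[of "x / (x + y)"] frac[of "y / (x + y)"] pos assms
    by (simp add: distrib_right)
  finally show ?thesis .
qed

text \<open>
  Where \<open>s \<le> t\<close>, the two powers in the kernel have bases \<open>(t - a) * (b - s) / (b - a)\<close> and
  \<open>t - s\<close>, which differ by \<open>(s - a) * (b - t) / (b - a) \<ge> 0\<close>.
\<close>

lemma green_nonneg:
  assumes "a < b" "1 < \<alpha>" "t \<in> {a..b}" "s \<in> {a..b}"
  shows "0 \<le> green \<alpha> a b t s"
proof -
  have "(t - s) powr (\<alpha> - 1) \<le> ((t - a) * (b - s) / (b - a)) powr (\<alpha> - 1)" if "s \<le> t"
  proof (rule powr_mono2)
    have "0 \<le> (s - a) * (b - t)" using assms by simp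
    also have "(s - a) * (b - t) = (t - a) * (b - s) - (t - s) * (b - a)"
      by (simp add: algebra_simps)
    finally show "t - s \<le> (t - a) * (b - s) / (b - a)"
      using assms by (simp add: le_divide_eq)
  qed (use assms that in auto)
  then show ?thesis
    using assms by (auto simp: green_def powr_mult powr_divide intro!: divide_nonneg_nonneg)
qed

text \<open>
  Up to the factor \<open>1 / Gamma \<alpha>\<close>: for \<open>t < s\<close> the kernel increases with \<open>t\<close>. For \<open>s \<le> t\<close>,
  moving \<open>t\<close> away from \<open>s\<close> raises the first term by \<open>k * ((t - a) powr c - (s - a) powr c)\<close>
  with \<open>c = \<alpha> - 1\<close> and \<open>k = ((b - s) / (b - a)) powr c \<le> 1\<close>; as \<open>c \<le> 1\<close>, subadditivity of the
  power bounds this by the subtracted term \<open>(t - s) powr c\<close>. This is where \<open>\<alpha> \<le> 2\<close> enters.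
\<close>

lemma green_le_diagonal:
  assumes "a < b" "1 < \<alpha>" "\<alpha> \<le> 2" "t \<in> {a..b}" "s \<in> {a..b}"
  shows "green \<alpha> a b t s \<le> green \<alpha> a b s s"
proof -
  define c where "c = \<alpha> - 1"
  define k where "k = (b - s) powr c / (b - a) powr c"
  have c: "0 < c" "c \<le> 1" using assms by (auto simp: c_def)
  have k: "0 \<le> k" "k \<le> 1"
    using assms c by (auto simp: k_def divide_le_eq_1 intro!: powr_mono2)
  have "k * (t - a) powr c - (if s \<le> t then (t - s) powr c else 0) \<le> k * (s - a) powr c"
  proof (cases "s \<le> t")
    case True
    have "(t - a) powr c \<le> (s - a) powr c + (t - s) powr c"
      using powr_subadditive[of "s - a" "t - s" c] assms c True by simp
    then have "k * (t - a) powr c \<le> k * (s - a) powr c + k * (t - s) powr c"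
      using k by (simp flip: distrib_left add: mult_left_mono)
    also have "k * (t - s) powr c \<le> (t - s) powr c"
      using k by (simp add: mult_left_le_one_le)
    finally show ?thesis using True by simp
  next
    case False
    then show ?thesis
      using assms c k by (auto intro!: mult_left_mono powr_mono2)
  qed
  moreover have "green \<alpha> a b t s
      = 1 / Gamma \<alpha> * (k * (t - a) powr c - (if s \<le> t then (t - s) powr c else 0))"
    by (simp add: green_def k_def c_def)
  moreover have "green \<alpha> a b s s = 1 / Gamma \<alpha> * (k * (s - a) powr c)"
    using c by (simp add: green_def k_def c_def)
  moreover have "0 \<le> 1 / Gamma \<alpha>" using assms by (simp add: less_imp_le)
  ultimately show ?thesis by (metis mult_left_mono)
qed

lemma green_less:
  assumes "a < b" "1 < \<alpha>" "\<alpha> \<le> 2" "t \<in> {a..b}" "s \<in> {a..b}" "s \<noteq> (a + b) / 2"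
  shows "green \<alpha> a b t s < (b - a) powr (\<alpha> - 1) / (4 powr (\<alpha> - 1) * Gamma \<alpha>)"
proof -
  have "0 < (2 * s - (a + b))\<^sup>2" using assms by simp
  then have "(s - a) * (b - s) < (b - a)\<^sup>2 / 4"
    by (simp add: power2_eq_square algebra_simps)
  then have "(s - a) * (b - s) / (b - a) < (b - a) / 4"
    using assms by (simp add: divide_less_eq power2_eq_square)
  then have less: "((s - a) * (b - s) / (b - a)) powr (\<alpha> - 1) < ((b - a) / 4) powr (\<alpha> - 1)"
    using assms by (intro powr_less_mono2) auto
  have "green \<alpha> a b t s \<le> green \<alpha> a b s s"
    using assms by (intro green_le_diagonal)
  also have "green \<alpha> a b s s = ((s - a) * (b - s) / (b - a)) powr (\<alpha> - 1) / Gamma \<alpha>"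
    using assms by (simp add: green_def powr_mult powr_divide)
  also have "\<dots> < ((b - a) / 4) powr (\<alpha> - 1) / Gamma \<alpha>"
    using less assms by (intro divide_strict_right_mono) auto
  also have "\<dots> = (b - a) powr (\<alpha> - 1) / (4 powr (\<alpha> - 1) * Gamma \<alpha>)"
    using assms by (simp add: powr_divide)
  finally show ?thesis .
qed

text \<open>
  In the application \<open>g\<close> and \<open>h\<close> both carry a factor \<open>q\<close>, so the strict pointwise inequality
  is available only off the zeros of \<open>q\<close>; a dominating function that is not almost everywhere zero
  is still enough for strict inequality of the integrals.
\<close>

lemma integral_less_of_AE_less_off_zeros:
  fixes g h :: "'a \<Rightarrow> real"
  assumes "integrable M g" "integrable M h"
    and less: "AE x in M. h x = 0 \<and> g x = 0 \<or> g x < h x"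
    and nontriv: "\<not> (AE x in M. h x = 0)"
  shows "integral\<^sup>L M g < integral\<^sup>L M h"
proof -
  have le: "AE x in M. g x \<le> h x" using less by eventually_elim auto
  have "integral\<^sup>L M g \<noteq> integral\<^sup>L M h"
  proof
    assume "integral\<^sup>L M g = integral\<^sup>L M h"
    then have "(LINT x|M. h x - g x) = 0" using assms by simp
    then have "AE x in M. h x - g x = 0"
      using le assms by (subst (asm) integral_nonneg_eq_0_iff_AE) auto
    then have "AE x in M. h x = 0" using less by eventually_elim auto
    then show False using nontriv by contradiction
  qed
  moreover have "integral\<^sup>L M g \<le> integral\<^sup>L M h"
    using assms le by (intro integral_mono_AE)
  ultimately show ?thesis by simp
qed

theorem theorem10:
  fixes a b \<alpha> \<eta> :: real and q f y :: "real \<Rightarrow> real"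
  assumes "a < b" and "1 < \<alpha>" and "\<alpha> \<le> 2"
    and "set_integrable lebesgue {a..b} q"
    and "\<not> (AE t in lebesgue_on {a..b}. q t = 0)"
    and "continuous_on {0..} f" and "\<forall>x\<ge>0. f x \<ge> 0"
    and "concave_on {0..} f" and "mono_on {0..} f"
    and "frac_bvp_solution \<alpha> a b q f y"
    and "\<exists>t\<in>{a..b}. y t \<noteq> 0"
    and "\<eta> = (SUP t\<in>{a..b}. y t)"
  shows "(LINT t:{a..b}|lebesgue. \<bar>q t\<bar>)
           > 4 powr (\<alpha> - 1) * Gamma \<alpha> * \<eta> / ((b - a) powr (\<alpha> - 1) * f \<eta>)"
proof -
  define K where "K = (b - a) powr (\<alpha> - 1) / (4 powr (\<alpha> - 1) * Gamma \<alpha>)"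
  define M where "M = lebesgue_on {a..b}"
  have LINT_M: "(LINT t:{a..b}|lebesgue. g t) = integral\<^sup>L M g" for g :: "real \<Rightarrow> real"
    unfolding M_def set_lebesgue_integral_def by (simp add: integral_restrict_space)
  have space_M: "space M = {a..b}" by (simp add: M_def)
  have "K > 0" using assms(1,2) by (simp add: K_def)

  have y_nonneg: "0 \<le> y t" if "t \<in> {a..b}" for t
    using assms(10) that unfolding frac_bvp_solution_def by blast
  have y_le: "y t \<le> \<eta>" if "t \<in> {a..b}" for t
    using frac_bvp_solution_SUP_attained(2)[OF _ assms(10) that] assms(1,12) by simp
  obtain t where t: "t \<in> {a..b}" "y t = \<eta>"
    using frac_bvp_solution_SUP_attained(1)[OF _ assms(10)] assms(1,12) by force
  have "\<eta> > 0" using assms(11) y_nonneg y_le by force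
  define u where "u = (\<lambda>s. green \<alpha> a b t s * q s * f (y s))"
  have \<eta>_eq: "\<eta> = integral\<^sup>L M u"
    using assms(10) t by (simp add: frac_bvp_solution_def u_def LINT_M)
  \<comment> \<open>The Bochner integral of a non-integrable function is \<open>0\<close>, but this one equals \<open>\<eta> > 0\<close>.\<close>
  have int_u: "integrable M u"
    using \<eta>_eq \<open>\<eta> > 0\<close> not_integrable_integral_eq by fastforce
  have fy: "0 \<le> f (y s)" "f (y s) \<le> f \<eta>" if "s \<in> {a..b}" for s
    using assms(7) mono_onD[OF assms(9)] y_nonneg[OF that] y_le[OF that] \<open>\<eta> > 0\<close> by auto
  have f\<eta>: "f \<eta> > 0"
  proof (rule ccontr)
    assume "\<not> f \<eta> > 0"
    then have "f (y s) = 0" if "s \<in> {a..b}" for s using fy[OF that] by simp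
    then have "integral\<^sup>L M u = 0"
      by (intro integral_eq_zero_AE) (auto simp: u_def space_M)
    then show False using \<eta>_eq \<open>\<eta> > 0\<close> by simp
  qed

  have "AE s in lebesgue. s \<noteq> (a + b) / 2"
    using AE_completion[OF AE_lborel_singleton[of "(a + b) / 2"]] by simp
  then have off_midpoint: "AE s in M. s \<noteq> (a + b) / 2"
    unfolding M_def by (subst AE_restrict_space_iff) auto
  have "integral\<^sup>L M u < (LINT s|M. K * f \<eta> * \<bar>q s\<bar>)"
  proof (rule integral_less_of_AE_less_off_zeros)
    show "integrable M u" by fact
    show "integrable M (\<lambda>s. K * f \<eta> * \<bar>q s\<bar>)"
      using assms(4) by (simp add: M_def set_integrable_def integrable_restrict_space)
    show "\<not> (AE s in M. K * f \<eta> * \<bar>q s\<bar> = 0)"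
      using assms(5)[folded M_def] \<open>K > 0\<close> f\<eta> by simp
    have pointwise: "K * f \<eta> * \<bar>q s\<bar> = 0 \<and> u s = 0 \<or> u s < K * f \<eta> * \<bar>q s\<bar>"
      if "s \<in> {a..b}" "s \<noteq> (a + b) / 2" for s
    proof (cases "q s = 0")
      case False
      have G: "0 \<le> green \<alpha> a b t s" "green \<alpha> a b t s < K"
        using green_nonneg[of a b \<alpha> t s] green_less[of a b \<alpha> t s] assms(1-3) t that
        by (auto simp: K_def)
      have "u s \<le> (green \<alpha> a b t s * f (y s)) * \<bar>q s\<bar>"
        using mult_left_mono[of "q s" "\<bar>q s\<bar>" "green \<alpha> a b t s * f (y s)"] G fy[OF that(1)]
        by (simp add: u_def mult_ac)
      also have "\<dots> < (K * f \<eta>) * \<bar>q s\<bar>"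
      proof (rule mult_strict_right_mono)
        have "green \<alpha> a b t s * f (y s) \<le> green \<alpha> a b t s * f \<eta>"
          using G fy[OF that(1)] by (intro mult_left_mono)
        also have "\<dots> < K * f \<eta>" using G f\<eta> by simp
        finally show "green \<alpha> a b t s * f (y s) < K * f \<eta>" .
      qed (use False in simp)
      finally show ?thesis by simp
    qed (simp add: u_def)
    show "AE s in M. K * f \<eta> * \<bar>q s\<bar> = 0 \<and> u s = 0 \<or> u s < K * f \<eta> * \<bar>q s\<bar>"
      using off_midpoint AE_space[of M] unfolding space_M by eventually_elim (use pointwise in blast)
  qed
  then have "\<eta> < K * f \<eta> * (LINT t:{a..b}|lebesgue. \<bar>q t\<bar>)"
    unfolding LINT_M using \<eta>_eq by simp
  then have "\<eta> / (K * f \<eta>) < (LINT t:{a..b}|lebesgue. \<bar>q t\<bar>)"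
    using \<open>K > 0\<close> f\<eta> by (simp add: divide_less_eq mult.commute)
  moreover have "\<eta> / (K * f \<eta>) = 4 powr (\<alpha> - 1) * Gamma \<alpha> * \<eta> / ((b - a) powr (\<alpha> - 1) * f \<eta>)"
    by (simp add: K_def)
  ultimately show ?thesis by simp
qed

end
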